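(* Let $R$ be a ring and $\sigma$ an endomorphism of $R$. Suppose that $R$ satisfies the condition $(\mathcal{C}_{\sigma})$. Then: (1) $R$ is reversible if and only if $R$ is $\sigma$-reversible; (2) $R$ is symmetric if and only if $R$ is $\sigma$-symmetric.
   Context: Rings are associative with unity, not necessarily commutative; $\sigma$ is a ring endomorphism of $R$. Condition $(\mathcal{C}_{\sigma})$: whenever $a\sigma(b)=0$ with $a,b\in R$, then $ab=0$. $R$ is reversible if $ab=0$ implies $ba=0$ for all $a,b\in R$; $R$ is symmetric if $abc=0$ implies $acb=0$ for all $a,b,c\in R$. $R$ is right (respectively, left) $\sigma$-reversible if whenever $ab=0$ for $a,b\in R$, then $b\sigma(a)=0$ (respectively, $\sigma(b)a=0$); $R$ is $\sigma$-reversible if it is both right and left $\sigma$-reversible. $R$ is right (respectively, left) $\sigma$-symmetric if whenever $abc=0$ for $a,b,c\in R$, then $ac\sigma(b)=0$ (respectively, $\sigma(b)ac=0$); $R$ is $\sigma$-symmetric if it is both right and left $\sigma$-symmetric. *)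

theory Defs
  imports "HOL-Algebra.RingHom"
begin

definition cond_C :: "('a, 'b) ring_scheme \<Rightarrow> ('a \<Rightarrow> 'a) \<Rightarrow> bool" where
  "cond_C R \<sigma> \<longleftrightarrow> (\<forall>a\<in>carrier R. \<forall>b\<in>carrier R.
     a \<otimes>\<^bsub>R\<^esub> \<sigma> b = \<zero>\<^bsub>R\<^esub> \<longrightarrow> a \<otimes>\<^bsub>R\<^esub> b = \<zero>\<^bsub>R\<^esub>)"

definition reversible_ring :: "('a, 'b) ring_scheme \<Rightarrow> bool" where
  "reversible_ring R \<longleftrightarrow> (\<forall>a\<in>carrier R. \<forall>b\<in>carrier R.
     a \<otimes>\<^bsub>R\<^esub> b = \<zero>\<^bsub>R\<^esub> \<longrightarrow> b \<otimes>\<^bsub>R\<^esub> a = \<zero>\<^bsub>R\<^esub>)"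

definition symmetric_ring :: "('a, 'b) ring_scheme \<Rightarrow> bool" where
  "symmetric_ring R \<longleftrightarrow> (\<forall>a\<in>carrier R. \<forall>b\<in>carrier R. \<forall>c\<in>carrier R.
     a \<otimes>\<^bsub>R\<^esub> b \<otimes>\<^bsub>R\<^esub> c = \<zero>\<^bsub>R\<^esub> \<longrightarrow> a \<otimes>\<^bsub>R\<^esub> c \<otimes>\<^bsub>R\<^esub> b = \<zero>\<^bsub>R\<^esub>)"

definition right_sigma_reversible :: "('a, 'b) ring_scheme \<Rightarrow> ('a \<Rightarrow> 'a) \<Rightarrow> bool" where
  "right_sigma_reversible R \<sigma> \<longleftrightarrow> (\<forall>a\<in>carrier R. \<forall>b\<in>carrier R.
     a \<otimes>\<^bsub>R\<^esub> b = \<zero>\<^bsub>R\<^esub> \<longrightarrow> b \<otimes>\<^bsub>R\<^esub> \<sigma> a = \<zero>\<^bsub>R\<^esub>)"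

definition left_sigma_reversible :: "('a, 'b) ring_scheme \<Rightarrow> ('a \<Rightarrow> 'a) \<Rightarrow> bool" where
  "left_sigma_reversible R \<sigma> \<longleftrightarrow> (\<forall>a\<in>carrier R. \<forall>b\<in>carrier R.
     a \<otimes>\<^bsub>R\<^esub> b = \<zero>\<^bsub>R\<^esub> \<longrightarrow> \<sigma> b \<otimes>\<^bsub>R\<^esub> a = \<zero>\<^bsub>R\<^esub>)"

definition sigma_reversible :: "('a, 'b) ring_scheme \<Rightarrow> ('a \<Rightarrow> 'a) \<Rightarrow> bool" where
  "sigma_reversible R \<sigma> \<longleftrightarrow> right_sigma_reversible R \<sigma> \<and> left_sigma_reversible R \<sigma>"

definition right_sigma_symmetric :: "('a, 'b) ring_scheme \<Rightarrow> ('a \<Rightarrow> 'a) \<Rightarrow> bool" where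
  "right_sigma_symmetric R \<sigma> \<longleftrightarrow> (\<forall>a\<in>carrier R. \<forall>b\<in>carrier R. \<forall>c\<in>carrier R.
     a \<otimes>\<^bsub>R\<^esub> b \<otimes>\<^bsub>R\<^esub> c = \<zero>\<^bsub>R\<^esub> \<longrightarrow> a \<otimes>\<^bsub>R\<^esub> c \<otimes>\<^bsub>R\<^esub> \<sigma> b = \<zero>\<^bsub>R\<^esub>)"

definition left_sigma_symmetric :: "('a, 'b) ring_scheme \<Rightarrow> ('a \<Rightarrow> 'a) \<Rightarrow> bool" where
  "left_sigma_symmetric R \<sigma> \<longleftrightarrow> (\<forall>a\<in>carrier R. \<forall>b\<in>carrier R. \<forall>c\<in>carrier R.
     a \<otimes>\<^bsub>R\<^esub> b \<otimes>\<^bsub>R\<^esub> c = \<zero>\<^bsub>R\<^esub> \<longrightarrow> \<sigma> b \<otimes>\<^bsub>R\<^esub> a \<otimes>\<^bsub>R\<^esub> c = \<zero>\<^bsub>R\<^esub>)"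

definition sigma_symmetric :: "('a, 'b) ring_scheme \<Rightarrow> ('a \<Rightarrow> 'a) \<Rightarrow> bool" where
  "sigma_symmetric R \<sigma> \<longleftrightarrow> right_sigma_symmetric R \<sigma> \<and> left_sigma_symmetric R \<sigma>"

end

theory Submission
  imports Defs
begin

text \<open>
  Applying \<open>\<sigma>\<close> to \<open>x y = 0\<close> gives \<open>\<sigma>(x) \<sigma>(y) = 0\<close>, and the condition on \<open>\<sigma>\<close> then
  strips the right-hand \<open>\<sigma>\<close>, leaving \<open>\<sigma>(x) y = 0\<close>. So \<open>\<sigma>\<close> may be put on the left
  factor of any vanishing product. In a reversible ring the two factors may also be
  swapped, which gives both forms of \<open>\<sigma>\<close>-reversibility.

  The symmetric case reduces to the reversible one: the unit makes a symmetric ring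
  reversible, and if \<open>a b c = 0\<close> then \<open>(a c) b = 0\<close>, so \<open>\<sigma>\<close>-reversibility applied to the
  two factors \<open>a c\<close> and \<open>b\<close> gives \<open>\<sigma>\<close>-symmetry.

  In both converses right \<open>\<sigma>\<close>-reversibility or right \<open>\<sigma>\<close>-symmetry puts \<open>\<sigma>\<close> on the last factor, exactly
  where the condition on \<open>\<sigma>\<close> removes it.
\<close>

lemma cond_CD:
  assumes "cond_C R \<sigma>" "a \<in> carrier R" "b \<in> carrier R"
    and "a \<otimes>\<^bsub>R\<^esub> \<sigma> b = \<zero>\<^bsub>R\<^esub>"
  shows "a \<otimes>\<^bsub>R\<^esub> b = \<zero>\<^bsub>R\<^esub>"
  using assms unfolding cond_C_def by blast

lemma reversible_ringD:
  assumes "reversible_ring R" "a \<in> carrier R" "b \<in> carrier R"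
    and "a \<otimes>\<^bsub>R\<^esub> b = \<zero>\<^bsub>R\<^esub>"
  shows "b \<otimes>\<^bsub>R\<^esub> a = \<zero>\<^bsub>R\<^esub>"
  using assms unfolding reversible_ring_def by blast

lemma symmetric_ringD:
  assumes "symmetric_ring R" "a \<in> carrier R" "b \<in> carrier R" "c \<in> carrier R"
    and "a \<otimes>\<^bsub>R\<^esub> b \<otimes>\<^bsub>R\<^esub> c = \<zero>\<^bsub>R\<^esub>"
  shows "a \<otimes>\<^bsub>R\<^esub> c \<otimes>\<^bsub>R\<^esub> b = \<zero>\<^bsub>R\<^esub>"
  using assms unfolding symmetric_ring_def by blast

text \<open>The unit supplies the missing third factor: \<open>a b\<close> is read as the triple product \<open>1 a b\<close>.\<close>

lemma (in ring) symmetric_imp_reversible: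
  assumes "symmetric_ring R"
  shows "reversible_ring R"
  unfolding reversible_ring_def
proof (intro ballI impI)
  fix a b assume "a \<in> carrier R" "b \<in> carrier R" "a \<otimes> b = \<zero>"
  then show "b \<otimes> a = \<zero>"
    using symmetric_ringD[OF assms, of \<one> a b] by simp
qed

text \<open>
  Multiplicativity of \<open>\<sigma>\<close> can only put \<open>\<sigma>\<close> on both factors at once; the condition on
  \<open>\<sigma>\<close> then frees the right one.
\<close>

lemma (in ring) zero_product_apply_left:
  assumes hom: "\<sigma> \<in> ring_hom R R" and C: "cond_C R \<sigma>"
    and x: "x \<in> carrier R" and y: "y \<in> carrier R" and "x \<otimes> y = \<zero>"
  shows "\<sigma> x \<otimes> y = \<zero>"
proof -
  have "\<sigma> x \<otimes> \<sigma> y = \<sigma> (x \<otimes> y)"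
    using ring_hom_mult[OF hom x y] by simp
  also have "\<dots> = \<zero>"
    using \<open>x \<otimes> y = \<zero>\<close> ring_hom_zero[OF hom ring_axioms ring_axioms] by simp
  finally show ?thesis
    using cond_CD[OF C ring_hom_closed[OF hom x] y] by simp
qed

lemma (in ring) reversible_imp_sigma_reversible:
  assumes hom: "\<sigma> \<in> ring_hom R R" and C: "cond_C R \<sigma>" and rev: "reversible_ring R"
  shows "sigma_reversible R \<sigma>"
  unfolding sigma_reversible_def right_sigma_reversible_def left_sigma_reversible_def
proof (intro conjI ballI impI)
  fix a b assume a: "a \<in> carrier R" and b: "b \<in> carrier R" and ab: "a \<otimes> b = \<zero>"
  show "b \<otimes> \<sigma> a = \<zero>"
    using reversible_ringD[OF rev ring_hom_closed[OF hom a] b]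
      zero_product_apply_left[OF hom C a b ab] by simp
  show "\<sigma> b \<otimes> a = \<zero>"
    using zero_product_apply_left[OF hom C b a] reversible_ringD[OF rev a b ab] by simp
qed

lemma right_sigma_reversible_imp_reversible:
  assumes "cond_C R \<sigma>" "right_sigma_reversible R \<sigma>"
  shows "reversible_ring R"
  using assms unfolding cond_C_def right_sigma_reversible_def reversible_ring_def by blast

text \<open>
  Treating \<open>a c\<close> as one factor opposite \<open>b\<close> turns a statement about three factors
  into \<open>\<sigma>\<close>-reversibility for two.
\<close>

lemma (in ring) symmetric_imp_sigma_symmetric:
  assumes hom: "\<sigma> \<in> ring_hom R R" and C: "cond_C R \<sigma>" and sym: "symmetric_ring R"
  shows "sigma_symmetric R \<sigma>"
  unfolding sigma_symmetric_def right_sigma_symmetric_def left_sigma_symmetric_def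
proof (intro conjI ballI impI)
  have rev: "reversible_ring R"
    using sym by (rule symmetric_imp_reversible)
  have srev: "right_sigma_reversible R \<sigma>" "left_sigma_reversible R \<sigma>"
    using reversible_imp_sigma_reversible[OF hom C rev]
    unfolding sigma_reversible_def by auto
  fix a b c
  assume a: "a \<in> carrier R" and b: "b \<in> carrier R" and c: "c \<in> carrier R"
    and abc: "a \<otimes> b \<otimes> c = \<zero>"
  have ac: "a \<otimes> c \<in> carrier R"
    using a c by simp
  have acb: "(a \<otimes> c) \<otimes> b = \<zero>"
    using sym a b c abc by (rule symmetric_ringD)
  have bac: "b \<otimes> (a \<otimes> c) = \<zero>"
    using rev ac b acb by (rule reversible_ringD)
  show "a \<otimes> c \<otimes> \<sigma> b = \<zero>"
    using srev(1) ac b bac unfolding right_sigma_reversible_def by blast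
  have "\<sigma> b \<otimes> (a \<otimes> c) = \<zero>"
    using srev(2) ac b acb unfolding left_sigma_reversible_def by blast
  then show "\<sigma> b \<otimes> a \<otimes> c = \<zero>"
    using m_assoc[OF ring_hom_closed[OF hom b] a c] by simp
qed

lemma (in ring) right_sigma_symmetric_imp_symmetric:
  assumes C: "cond_C R \<sigma>" and sym: "right_sigma_symmetric R \<sigma>"
  shows "symmetric_ring R"
  unfolding symmetric_ring_def
proof (intro ballI impI)
  fix a b c
  assume a: "a \<in> carrier R" and b: "b \<in> carrier R" and c: "c \<in> carrier R"
    and "a \<otimes> b \<otimes> c = \<zero>"
  then have "a \<otimes> c \<otimes> \<sigma> b = \<zero>"
    using sym unfolding right_sigma_symmetric_def by blast
  then show "a \<otimes> c \<otimes> b = \<zero>"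
    using cond_CD[OF C m_closed[OF a c] b] by simp
qed

theorem lemma3p1:
  fixes R :: "('a, 'b) ring_scheme" and \<sigma> :: "'a \<Rightarrow> 'a"
  assumes "ring R"
    and "\<sigma> \<in> ring_hom R R"
    and "cond_C R \<sigma>"
  shows "(reversible_ring R \<longleftrightarrow> sigma_reversible R \<sigma>) \<and>
         (symmetric_ring R \<longleftrightarrow> sigma_symmetric R \<sigma>)"
proof -
  interpret ring R by fact
  show ?thesis
    using reversible_imp_sigma_reversible[OF assms(2,3)]
      right_sigma_reversible_imp_reversible[OF assms(3)]
      symmetric_imp_sigma_symmetric[OF assms(2,3)]
      right_sigma_symmetric_imp_symmetric[OF assms(3)]
    unfolding sigma_reversible_def sigma_symmetric_def by blast
qed

end
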